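(* Let $d\ge1$ and $d+1\le r\le 2d$ be integers. There exist constants $C>0$ and $n_0$ (depending only on $d$ and $r$) such that for all integers $n\ge n_0$, $$\overleftarrow{m}_{mon}(\mathbb{T}_n^d,r)\ \le\ 2\Big(1-\frac{d}{r}\Big)n^d+Cn^{d-1}.$$
   Context: The $d$-dimensional torus $\mathbb{T}_n^d$ is the graph with vertex set $[n]^d=\{1,\dots,n\}^d$, where two vertices are adjacent iff they differ in exactly one coordinate $j$ and in that coordinate $x_j-x'_j\equiv\pm1\pmod n$. A configuration assigns each vertex a state active (1) or inactive (0); its size is the number of active vertices. Reversible $r$-bootstrap percolation: in each round $t\ge1$, simultaneously, every vertex becomes active if it has at least $r$ active neighbors in round $t-1$ and inactive otherwise. A dynamo is an initial configuration $\omega^{(0)}$ such that from some time on all vertices are active forever; it is monotone if moreover $\omega^{(t+1)}\ge\omega^{(t)}$ coordinatewise for all $t\ge0$ (no active vertex ever becomes inactive). $\overleftarrow{m}_{mon}(G,r)$ denotes the minimum size of a monotone dynamo under reversible $r$-bootstrap percolation on $G$. *)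

theory Defs
  imports Complex_Main "HOL-Library.FuncSet" "HOL-Number_Theory.Cong"
begin

text \<open>A graph is given by its vertex set \<open>V\<close> and adjacency relation \<open>E\<close>; a configuration is
  the set \<open>A \<subseteq> V\<close> of its active vertices, so that its size is \<open>card A\<close> and the coordinatewise
  order on configurations is set inclusion.\<close>

definition torus_verts :: "nat \<Rightarrow> nat \<Rightarrow> (nat \<Rightarrow> nat) set" where
  "torus_verts d n = {1..d} \<rightarrow>\<^sub>E {1..n}"

definition torus_adj :: "nat \<Rightarrow> nat \<Rightarrow> (nat \<Rightarrow> nat) \<Rightarrow> (nat \<Rightarrow> nat) \<Rightarrow> bool" where
  "torus_adj d n x y \<longleftrightarrow>
     (\<exists>j\<in>{1..d}. x j \<noteq> y j \<and> (\<forall>i\<in>{1..d} - {j}. x i = y i) \<and>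
        ([int (x j) - int (y j) = 1] (mod int n) \<or> [int (x j) - int (y j) = - 1] (mod int n)))"

definition rev_step ::
    "'a set \<Rightarrow> ('a \<Rightarrow> 'a \<Rightarrow> bool) \<Rightarrow> nat \<Rightarrow> 'a set \<Rightarrow> 'a set" where
  "rev_step V E r A = {v \<in> V. r \<le> card {u \<in> V. E v u \<and> u \<in> A}}"

definition rev_config ::
    "'a set \<Rightarrow> ('a \<Rightarrow> 'a \<Rightarrow> bool) \<Rightarrow> nat \<Rightarrow> 'a set \<Rightarrow> nat \<Rightarrow> 'a set" where
  "rev_config V E r A t = (rev_step V E r ^^ t) A"

definition dynamo ::
    "'a set \<Rightarrow> ('a \<Rightarrow> 'a \<Rightarrow> bool) \<Rightarrow> nat \<Rightarrow> 'a set \<Rightarrow> bool" where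
  "dynamo V E r A \<longleftrightarrow> A \<subseteq> V \<and> (\<exists>T. \<forall>t\<ge>T. rev_config V E r A t = V)"

definition monotone_dynamo ::
    "'a set \<Rightarrow> ('a \<Rightarrow> 'a \<Rightarrow> bool) \<Rightarrow> nat \<Rightarrow> 'a set \<Rightarrow> bool" where
  "monotone_dynamo V E r A \<longleftrightarrow>
     dynamo V E r A \<and> (\<forall>t. rev_config V E r A t \<subseteq> rev_config V E r A (Suc t))"

text \<open>The infimum is a genuine minimum as soon as a monotone dynamo exists (otherwise it is the
  junk value \<open>0\<close>). The lemma \<open>torus_monotone_dynamo_exists\<close> below shows that on the torus this is
  the case whenever \<open>n \<ge> 3\<close> and \<open>r \<le> 2 * d\<close>.\<close>

definition m_mon :: "'a set \<Rightarrow> ('a \<Rightarrow> 'a \<Rightarrow> bool) \<Rightarrow> nat \<Rightarrow> nat" where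
  "m_mon V E r = Inf {card A |A. monotone_dynamo V E r A}"

lemma torus_degree:
  assumes n: "n \<ge> 3" and x: "x \<in> torus_verts d n"
  shows "2 * d \<le> card {u \<in> torus_verts d n. torus_adj d n x u}"
proof -
  define s where "s k = (if k = n then 1 else k + 1)" for k
  define p where "p k = (if k = 1 then n else k - 1)" for k
  define f where "f = (\<lambda>(j, b). x(j := if b then s (x j) else p (x j)))"
  have xj: "x j \<in> {1..n}" if "j \<in> {1..d}" for j
    using x that by (auto simp: torus_verts_def)
  have s: "s k \<in> {1..n}" "s k \<noteq> k" "[int k - int (s k) = - 1] (mod int n)"
    and p: "p k \<in> {1..n}" "p k \<noteq> k" "[int k - int (p k) = 1] (mod int n)"
    and sp: "s k \<noteq> p k" if "k \<in> {1..n}" for k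
    using n that by (auto simp: s_def p_def cong_iff_dvd_diff of_nat_diff split: if_splits)
  have sub: "f ` ({1..d} \<times> UNIV) \<subseteq> {u \<in> torus_verts d n. torus_adj d n x u}"
  proof clarify
    fix j b assume j: "j \<in> {1..d}"
    have V: "f (j, b) \<in> torus_verts d n"
      using x j s(1)[OF xj[OF j]] p(1)[OF xj[OF j]]
      by (auto simp: f_def torus_verts_def PiE_iff extensional_def)
    have "torus_adj d n x (f (j, b))"
      unfolding torus_adj_def using j s[OF xj[OF j]] p[OF xj[OF j]]
      by (intro bexI[of _ j]) (auto simp: f_def)
    with V show "f (j, b) \<in> torus_verts d n \<and> torus_adj d n x (f (j, b))" by blast
  qed
  have inj: "inj_on f ({1..d} \<times> UNIV)"
  proof (rule inj_onI, clarify)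
    fix i b j c assume i: "i \<in> {1..d}" and j: "j \<in> {1..d}" and eq: "f (i, b) = f (j, c)"
    have "f (i, b) i \<noteq> x i"
      using s[OF xj[OF i]] p[OF xj[OF i]] by (auto simp: f_def)
    with eq have ij: "i = j" by (auto simp: f_def split: if_splits)
    have "f (i, b) i = f (i, c) i" using eq ij by simp
    then show "i = j \<and> b = c"
      using ij sp[OF xj[OF i]] by (auto simp: f_def split: if_splits)
  qed
  have "finite (torus_verts d n)"
    by (simp add: torus_verts_def finite_PiE)
  then have "card (f ` ({1..d} \<times> UNIV)) \<le> card {u \<in> torus_verts d n. torus_adj d n x u}"
    by (intro card_mono sub) auto
  moreover have "card (f ` ({1..d} \<times> UNIV)) = 2 * d"
    unfolding card_image[OF inj] by (simp add: card_cartesian_product)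
  ultimately show ?thesis by simp
qed

lemma torus_monotone_dynamo_exists:
  assumes "n \<ge> 3" "r \<le> 2 * d"
  shows "monotone_dynamo (torus_verts d n) (torus_adj d n) r (torus_verts d n)"
proof -
  let ?V = "torus_verts d n" and ?E = "torus_adj d n"
  have "{u \<in> ?V. ?E v u \<and> u \<in> ?V} = {u \<in> ?V. ?E v u}" for v by blast
  then have fixed: "rev_step ?V ?E r ?V = ?V"
    unfolding rev_step_def using torus_degree[OF assms(1)] assms(2) le_trans by fastforce
  have "rev_config ?V ?E r ?V t = ?V" for t
    unfolding rev_config_def by (induction t) (simp_all add: fixed)
  then show ?thesis by (simp add: monotone_dynamo_def dynamo_def)
qed

end

theory Submission
  imports Defs
begin

text \<open>
  Put \<open>s = 2d - r\<close>. A set \<open>A\<close> of vertices is a monotone dynamo once every vertex of \<open>A\<close> has at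
  most \<open>s\<close> neighbours in the complement \<open>B\<close>, and \<open>B\<close> can be ordered such that every vertex of
  \<open>B\<close> has at most \<open>s\<close> later neighbours in \<open>B\<close>. Double counting edges shows that \<open>B\<close> has
  density at most \<open>s/r\<close>, and this is attained by a periodic set: give coordinate \<open>j\<close> the weight
  \<open>c\<^sub>j = j\<close> if \<open>j \<le> r/2\<close> and \<open>c\<^sub>j = 0\<close> otherwise, and let \<open>B\<close> be the set of all \<open>x\<close> with
  \<open>\<Sum>c\<^sub>j x\<^sub>j mod r \<in> S\<close>, where \<open>S\<close> consists of \<open>s\<close> equally spaced residues
  \<open>\<lceil>k r / s\<rceil>\<close>. The steps \<open>\<plusminus>c\<^sub>j\<close> run through all nonzero residues once (and once more
  through \<open>r/2\<close> if \<open>r\<close> is even, in which case \<open>S\<close> is invariant under the shift by \<open>r/2\<close>), so a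
  vertex outside \<open>B\<close> sees exactly \<open>s\<close> vertices of \<open>B\<close>. The equal spacing of \<open>S\<close> guarantees
  that a vertex of \<open>B\<close> has \<open>s\<close> of its \<open>2s\<close> neighbours in \<open>B\<close> in the positive directions, so that
  \<open>B\<close> becomes active in the order of increasing coordinate sums. Keeping the faces
  \<open>x\<^sub>j \<in> {1, n}\<close> active removes the wrap-around at the cost of \<open>O(n\<^sup>d\<^sup>-\<^sup>1)\<close> vertices.
\<close>

section \<open>Equally spaced residues\<close>

text \<open>For \<open>s > 0\<close>, membership means that \<open>a = \<lceil>k r / s\<rceil>\<close> for some \<open>k\<close>.\<close>

definition spaced :: "nat \<Rightarrow> nat \<Rightarrow> int \<Rightarrow> bool" where
  "spaced s r a \<longleftrightarrow> (int s * a) mod int r < int s"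

text \<open>Passing from \<open>a - 1\<close> to \<open>a\<close> adds \<open>s\<close>, at most
  \<open>r\<close>, to the product, so the quotient by \<open>r\<close> grows by 0 or 1, and by 1
  exactly when the new remainder is below \<open>s\<close>. Counts of spaced residues in windows
  therefore telescope.\<close>

lemma of_bool_spaced:
  assumes "s \<le> r" "0 < r"
  shows "of_bool (spaced s r a) = (int s * a) div int r - (int s * (a - 1)) div int r"
proof -
  define q m where "q = (int s * a) div int r" and "m = (int s * a) mod int r"
  have e: "int s * a = q * int r + m" by (simp add: q_def m_def)
  have m: "0 \<le> m" "m < int r" using assms by (auto simp: m_def)
  have e2: "int s * (a - 1) = q * int r + (m - int s)"
    using e by (simp add: algebra_simps)
  show ?thesis
  proof (cases "m < int s")
    case True
    have "(int s * (a - 1)) div int r = q - 1"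
      by (rule int_div_pos_eq[where r = "m - int s + int r"])
        (use e2 True m assms in \<open>auto simp: algebra_simps\<close>)
    with True show ?thesis by (simp add: spaced_def m_def q_def)
  next
    case False
    have "(int s * (a - 1)) div int r = q"
      by (rule int_div_pos_eq[where r = "m - int s"])
        (use e2 False m assms in \<open>auto simp: algebra_simps\<close>)
    with False show ?thesis by (simp add: spaced_def m_def q_def)
  qed
qed

lemma card_filter_Suc:
  "card {j \<in> {1..Suc L}. P j} = card {j \<in> {1..L}. P j} + of_bool (P (Suc L))"
proof -
  have "{j \<in> {1..Suc L}. P j}
      = (if P (Suc L) then insert (Suc L) {j \<in> {1..L}. P j} else {j \<in> {1..L}. P j})"
    by (auto simp: le_Suc_eq)
  then show ?thesis by simp
qed

lemma card_spaced_above: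
  assumes "s \<le> r" "0 < r"
  shows "int (card {j \<in> {1..L}. spaced s r (a + int j)})
    = (int s * (a + int L)) div int r - (int s * a) div int r"
proof (induction L)
  case (Suc L)
  show ?case
    unfolding card_filter_Suc of_nat_add Suc.IH of_nat_of_bool of_bool_spaced[OF assms]
    by (simp add: algebra_simps)
qed simp

lemma card_spaced_below:
  assumes "s \<le> r" "0 < r"
  shows "int (card {j \<in> {1..L}. spaced s r (a - int j)})
    = (int s * (a - 1)) div int r - (int s * (a - 1 - int L)) div int r"
proof (induction L)
  case (Suc L)
  show ?case
    unfolding card_filter_Suc of_nat_add Suc.IH of_nat_of_bool of_bool_spaced[OF assms]
    by (simp add: algebra_simps)
qed simp

lemma spaced_shift_half:
  assumes "even s" "even r"
  shows "spaced s r (a - int (r div 2)) \<longleftrightarrow> spaced s r a"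
proof -
  obtain k l where "s = 2 * k" "r = 2 * l" using assms by (auto elim!: evenE)
  then have "int s * (a - int (r div 2)) = int s * a + (- int k) * int r"
    by (simp add: algebra_simps)
  then show ?thesis by (simp only: spaced_def mod_mult_self1)
qed

text \<open>Since \<open>a\<close> itself is not spaced, the two windows merge into the interval
  from \<open>a - h\<close> to \<open>a + h\<close>, where \<open>h = r div 2\<close>. For odd
  \<open>r\<close> this is one full period, with \<open>s\<close> spaced residues. For even
  \<open>r\<close> it is longer by one, but its end \<open>a - h\<close> is not spaced by
  \<open>spaced_shift_half\<close>.\<close>

lemma card_spaced_around:
  assumes "s \<le> r" "0 < r" "even (s + r)" "\<not> spaced s r a"
  shows "card {j \<in> {1..r div 2}. spaced s r (a + int j)}
    + card {j \<in> {1..r div 2}. spaced s r (a - int j)} \<le> s"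
proof -
  define h where "h = r div 2"
  define f where "f b = (int s * b) div int r" for b
  have per: "f (b + int r) = f b + int s" for b
    using assms by (simp add: f_def distrib_left)
  have step: "f b = f (b - 1) + of_bool (spaced s r b)" for b
    using of_bool_spaced[OF assms(1,2)] by (simp add: f_def)
  have "int (card {j \<in> {1..h}. spaced s r (a + int j)}
      + card {j \<in> {1..h}. spaced s r (a - int j)}) = f (a + int h) - f a + (f (a - 1) - f (a - 1 - int h))"
    unfolding of_nat_add card_spaced_above[OF assms(1,2)] card_spaced_below[OF assms(1,2)] f_def ..
  also have "\<dots> = f (a + int h) - f (a - 1 - int h)"
    using step[of a] assms(4) by simp
  also have "\<dots> = int s"
  proof (cases "even r")
    case True
    then have r: "int r = 2 * int h" by (auto simp: h_def)
    have "\<not> spaced s r (a - int h)"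
      using spaced_shift_half[of s r a] True assms(3,4) by (simp add: h_def)
    then have "f (a - int h) = f (a - 1 - int h)"
      using step[of "a - int h"] by (simp add: algebra_simps)
    moreover have "f (a + int h) = f (a - int h) + int s"
      using per[of "a - int h"] r by (simp add: algebra_simps)
    ultimately show ?thesis by simp
  next
    case False
    then have "r = 2 * h + 1" by (simp add: h_def)
    then have "int r = 2 * int h + 1" by simp
    then show ?thesis
      using per[of "a - 1 - int h"] by (simp add: algebra_simps)
  qed
  finally show ?thesis by (simp add: h_def)
qed

text \<open>The remainder \<open>m\<close> of \<open>s * a\<close> is below \<open>s\<close>, and
  \<open>m + s * (r div 2)\<close> stays below \<open>(s div 2 + 1) * r\<close> for either common
  parity of \<open>s\<close> and \<open>r\<close>; so the quotient grows by at most
  \<open>s div 2\<close>.\<close>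

lemma card_spaced_half:
  assumes "s \<le> r" "0 < r" "even (s + r)" "spaced s r a"
  shows "card {j \<in> {1..r div 2}. spaced s r (a + int j)} \<le> s div 2"
proof -
  define h where "h = r div 2"
  define q m where "q = (int s * a) div int r" and "m = (int s * a) mod int r"
  have e: "int s * a = q * int r + m" by (simp add: q_def m_def)
  have m: "0 \<le> m" "m < int s" using assms by (auto simp: m_def spaced_def)
  have "int s * (a + int h) < (q + int (s div 2) + 1) * int r"
  proof (cases "even r")
    case True
    then obtain k l where "s = 2 * k" "r = 2 * l" using assms(3) by (auto elim!: evenE)
    then show ?thesis using e m assms(1) by (simp add: h_def algebra_simps)
  next
    case False
    then obtain k l where kl: "s = 2 * k + 1" "r = 2 * l + 1" using assms(3) by (auto elim!: oddE)
    then have "int s * (a + int h) = q * int r + m + (2 * int k + 1) * int l"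
      using e by (simp add: h_def algebra_simps)
    moreover have "m \<le> 2 * int k" "k \<le> l" using m kl assms(1) by auto
    ultimately show ?thesis using kl by (simp add: algebra_simps)
  qed
  then have "(int s * (a + int h)) div int r * int r < (q + int (s div 2) + 1) * int r"
    using assms(2) div_mult_mod_eq[of "int s * (a + int h)" "int r"]
      pos_mod_sign[of "int r" "int s * (a + int h)"] by linarith
  then have "(int s * (a + int h)) div int r < q + int (s div 2) + 1"
    by (simp add: mult_less_cancel_right)
  then show ?thesis
    using card_spaced_above[OF assms(1,2), of h a] by (simp add: h_def q_def)
qed

section \<open>A criterion for monotone dynamos\<close>

lemma rev_step_mono:
  assumes "finite V" "A \<subseteq> B"
  shows "rev_step V E r A \<subseteq> rev_step V E r B"
proof -
  have "card {u \<in> V. E v u \<and> u \<in> A} \<le> card {u \<in> V. E v u \<and> u \<in> B}" for v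
    using assms by (intro card_mono) auto
  then show ?thesis by (auto simp: rev_step_def intro: le_trans)
qed

lemma mem_rev_stepI:
  assumes "finite V" "v \<in> V" "r + s \<le> card {u \<in> V. E v u}" "card {u \<in> V - A. E v u} \<le> s"
  shows "v \<in> rev_step V E r A"
proof -
  have "{u \<in> V. E v u} = {u \<in> V. E v u \<and> u \<in> A} \<union> {u \<in> V - A. E v u}" by blast
  then have "card {u \<in> V. E v u} \<le> card {u \<in> V. E v u \<and> u \<in> A} + card {u \<in> V - A. E v u}"
    by (metis card_Un_le)
  with assms show ?thesis by (simp add: rev_step_def)
qed

text \<open>By \<open>stable\<close>, \<open>A\<close> survives the first round, and monotonicity of
  the step carries this growth to all rounds. By \<open>ranked\<close>, a vertex outside
  \<open>A\<close> becomes active once all vertices of lower rank are active.\<close>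

lemma monotone_dynamo_if_ranked:
  fixes h :: "'a \<Rightarrow> nat"
  assumes fin: "finite V" and "A \<subseteq> V"
    and deg: "\<And>v. v \<in> V \<Longrightarrow> r + s \<le> card {u \<in> V. E v u}"
    and stable: "\<And>v. v \<in> A \<Longrightarrow> card {u \<in> V - A. E v u} \<le> s"
    and ranked: "\<And>v. v \<in> V - A \<Longrightarrow> card {u \<in> V - A. E v u \<and> h v \<le> h u} \<le> s"
  shows "monotone_dynamo V E r A"
proof -
  define K where "K = rev_config V E r A"
  have K0: "K 0 = A" and KS: "K (Suc t) = rev_step V E r (K t)" for t
    by (simp_all add: K_def rev_config_def)
  have mono: "K t \<subseteq> K (Suc t)" for t
  proof (induction t)
    case 0
    show ?case
      using stable deg \<open>A \<subseteq> V\<close> by (auto simp: K0 KS intro!: mem_rev_stepI[OF fin])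
  next
    case (Suc t)
    then show ?case unfolding KS[of "Suc t"] by (subst KS) (rule rev_step_mono[OF fin])
  qed
  have AK: "A \<subseteq> K t" for t
    by (induction t) (use mono K0 in blast)+
  have KV: "K t \<subseteq> V" for t
    by (cases t) (use \<open>A \<subseteq> V\<close> in \<open>auto simp: K0 KS rev_step_def\<close>)
  have low: "{v \<in> V. h v < t} \<subseteq> K t" for t
  proof (induction t)
    case (Suc t)
    show ?case
    proof
      fix v assume v: "v \<in> {v \<in> V. h v < Suc t}"
      show "v \<in> K (Suc t)"
      proof (cases "v \<in> A")
        case False
        \<comment> \<open>Here \<open>h v \<le> t\<close>, so every vertex of rank below
          \<open>h v\<close> is active in round \<open>t\<close> by induction.\<close>
        have "{u \<in> V - K t. E v u} \<subseteq> {u \<in> V - A. E v u \<and> h v \<le> h u}"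
          using Suc AK[of t] v by fastforce
        then have "card {u \<in> V - K t. E v u} \<le> card {u \<in> V - A. E v u \<and> h v \<le> h u}"
          using fin by (intro card_mono) auto
        also have "\<dots> \<le> s" using ranked v False by blast
        finally show ?thesis
          unfolding KS using v deg by (intro mem_rev_stepI[OF fin]) auto
      qed (use AK in blast)
    qed
  qed simp
  obtain T where T: "\<forall>v\<in>V. h v < T"
    using finite_imageI[OF fin, of h] finite_nat_set_iff_bounded by auto
  have "K t = V" if "t \<ge> T" for t
    using low[of t] KV[of t] T that by force
  then show ?thesis
    using mono \<open>A \<subseteq> V\<close> by (auto simp: monotone_dynamo_def dynamo_def K_def)
qed

section \<open>The periodic configuration\<close>

definition coord_weight :: "nat \<Rightarrow> nat \<Rightarrow> nat" where
  "coord_weight r j = (if 2 * j \<le> r then j else 0)"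

definition weight :: "nat \<Rightarrow> nat \<Rightarrow> (nat \<Rightarrow> nat) \<Rightarrow> int" where
  "weight d r x = (\<Sum>j\<in>{1..d}. int (coord_weight r j) * int (x j))"

definition inactive :: "nat \<Rightarrow> nat \<Rightarrow> nat \<Rightarrow> (nat \<Rightarrow> nat) set" where
  "inactive d r n = {x \<in> {1..d} \<rightarrow>\<^sub>E {2..n - 1}. spaced (2 * d - r) r (weight d r x)}"

lemma inactive_subset: "inactive d r n \<subseteq> torus_verts d n"
  by (fastforce simp: inactive_def torus_verts_def PiE_iff)

lemma finite_torus_verts: "finite (torus_verts d n)"
  by (simp add: torus_verts_def finite_PiE)

lemma sum_fun_upd_remove:
  fixes f :: "nat \<Rightarrow> nat \<Rightarrow> 'b::comm_monoid_add"
  assumes "finite J" "j \<in> J"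
  shows "(\<Sum>i\<in>J. f i ((x(j := y)) i)) = f j y + (\<Sum>i\<in>J - {j}. f i (x i))"
proof -
  have "(\<Sum>i\<in>J. f i ((x(j := y)) i)) = f j y + (\<Sum>i\<in>J - {j}. f i ((x(j := y)) i))"
    using assms by (subst sum.remove[of J j]) auto
  also have "(\<Sum>i\<in>J - {j}. f i ((x(j := y)) i)) = (\<Sum>i\<in>J - {j}. f i (x i))"
    by (intro sum.cong) auto
  finally show ?thesis .
qed

lemma weight_upd:
  assumes "j \<in> {1..d}"
  shows "weight d r (x(j := y)) = weight d r x + int (coord_weight r j) * (int y - int (x j))"
proof -
  have "weight d r x = int (coord_weight r j) * int (x j)
      + (\<Sum>i\<in>{1..d} - {j}. int (coord_weight r i) * int (x i))"
    unfolding weight_def using assms by (subst sum.remove[of _ j]) auto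
  then show ?thesis
    unfolding weight_def using assms by (subst sum_fun_upd_remove) (auto simp: algebra_simps)
qed

text \<open>Inactive vertices avoid the coordinate values 1 and \<open>n\<close>, so the differences
  in the congruences are too small to wrap around and the congruences become equations.\<close>

lemma inactive_neighbourE:
  assumes "x \<in> torus_verts d n" "u \<in> inactive d r n" "torus_adj d n x u"
  obtains j where "j \<in> {1..d}" "u = x(j := x j + 1)"
  | j where "j \<in> {1..d}" "x j \<ge> 1" "u = x(j := x j - 1)"
proof -
  obtain j where j: "j \<in> {1..d}" "\<forall>i\<in>{1..d} - {j}. x i = u i"
    and c: "[int (x j) - int (u j) = 1] (mod int n) \<or> [int (x j) - int (u j) = - 1] (mod int n)"
    using assms(3) by (auto simp: torus_adj_def)
  have x: "1 \<le> x j" "x j \<le> n" and u: "2 \<le> u j" "u j \<le> n - 1"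
    using assms(1,2) j(1) by (fastforce simp: torus_verts_def inactive_def PiE_iff)+
  have u_eq: "u = x(j := u j)"
  proof
    fix i
    show "u i = (x(j := u j)) i"
      using assms(1,2) j by (cases "i \<in> {1..d}")
        (auto simp: torus_verts_def inactive_def PiE_iff extensional_def)
  qed
  have zero: "k = 0" if "int n dvd k" "\<bar>k\<bar> < int n" for k
    using that zdvd_not_zless[of "\<bar>k\<bar>" "int n"] by fastforce
  from c have "int (x j) - int (u j) - 1 = 0 \<or> int (x j) - int (u j) + 1 = 0"
  proof
    assume "[int (x j) - int (u j) = 1] (mod int n)"
    then have "int n dvd int (x j) - int (u j) - 1" by (simp add: cong_iff_dvd_diff)
    then show ?thesis using x u by (intro disjI1 zero) auto
  next
    assume "[int (x j) - int (u j) = - 1] (mod int n)"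
    then have "int n dvd int (x j) - int (u j) + 1" by (simp add: cong_iff_dvd_diff)
    then show ?thesis using x u by (intro disjI2 zero) auto
  qed
  then consider "u j = x j - 1" | "u j = x j + 1" using x by linarith
  then show thesis
    using that u_eq j(1) x(1) by metis
qed

lemma card_coord_weight:
  assumes "r \<le> 2 * d"
  shows "card {j \<in> {1..d}. P (coord_weight r j)}
    = card {j \<in> {1..r div 2}. P j} + (if P 0 then d - r div 2 else 0)"
proof -
  have "{j \<in> {1..d}. P (coord_weight r j)}
      = {j \<in> {1..r div 2}. P j} \<union> {j \<in> {r div 2<..d}. P 0}"
    using assms by (auto simp: coord_weight_def)
  also have "card \<dots> = card {j \<in> {1..r div 2}. P j} + card {j \<in> {r div 2<..d}. P 0}"
    by (rule card_Un_disjoint) auto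
  also have "card {j \<in> {r div 2<..d}. P 0} = (if P 0 then d - r div 2 else 0)"
    by (cases "P 0") (simp_all only: simp_thms if_True if_False Collect_mem_eq
        card_greaterThanAtMost Collect_const card.empty)
  finally show ?thesis .
qed

text \<open>Inactive neighbours arise from steps that shift the weight by plus or minus
  \<open>coord_weight r j\<close>. Coordinates of weight 0 give none, as the weight of
  \<open>x\<close> is not spaced; \<open>card_spaced_around\<close> bounds the rest.\<close>

lemma card_inactive_neighbours_interior:
  assumes "r \<le> 2 * d" "d < r" and x: "x \<in> torus_verts d n"
    and nP: "\<not> spaced (2 * d - r) r (weight d r x)"
  shows "card {u \<in> inactive d r n. torus_adj d n x u} \<le> 2 * d - r"
proof -
  define s where "s = 2 * d - r"
  define a where "a = weight d r x"
  define U where "U = {j \<in> {1..d}. spaced s r (a + int (coord_weight r j))}"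
  define D where "D = {j \<in> {1..d}. spaced s r (a - int (coord_weight r j))}"
  have s: "s \<le> r" "0 < r" "even (s + r)" using assms by (auto simp: s_def)
  have "{u \<in> inactive d r n. torus_adj d n x u}
      \<subseteq> (\<lambda>j. x(j := x j + 1)) ` U \<union> (\<lambda>j. x(j := x j - 1)) ` D"
  proof
    fix u assume "u \<in> {u \<in> inactive d r n. torus_adj d n x u}"
    then have u: "u \<in> inactive d r n" "torus_adj d n x u" by auto
    then have P: "spaced s r (weight d r u)" by (simp add: inactive_def s_def)
    from x u show "u \<in> (\<lambda>j. x(j := x j + 1)) ` U \<union> (\<lambda>j. x(j := x j - 1)) ` D"
    proof (cases rule: inactive_neighbourE)
      case (1 j)
      with P have "j \<in> U" by (simp add: U_def weight_upd a_def)
      with 1 show ?thesis by blast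
    next
      case (2 j)
      with P have "j \<in> D" by (simp add: D_def weight_upd a_def of_nat_diff)
      with 2 show ?thesis by blast
    qed
  qed
  then have "card {u \<in> inactive d r n. torus_adj d n x u}
      \<le> card ((\<lambda>j. x(j := x j + 1)) ` U \<union> (\<lambda>j. x(j := x j - 1)) ` D)"
    by (intro card_mono) (auto simp: U_def D_def)
  also have "\<dots> \<le> card U + card D"
    by (intro order_trans[OF card_Un_le] add_mono card_image_le) (auto simp: U_def D_def)
  also have "\<dots> \<le> s"
    unfolding U_def D_def
    using card_coord_weight[OF assms(1), of "\<lambda>k. spaced s r (a + int k)"]
      card_coord_weight[OF assms(1), of "\<lambda>k. spaced s r (a - int k)"]
      card_spaced_around[OF s] nP by (simp add: a_def s_def)
  finally show ?thesis by (simp add: s_def)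
qed

text \<open>Only the step that leaves the face can reach an inactive vertex, and
  \<open>r < 2 * d\<close> allows one such neighbour.\<close>

lemma card_inactive_neighbours_face:
  assumes x: "x \<in> torus_verts d n" and j: "j \<in> {1..d}" "x j \<notin> {2..n - 1}"
    and "r < 2 * d"
  shows "card {u \<in> inactive d r n. torus_adj d n x u} \<le> 2 * d - r"
proof -
  have "{u \<in> inactive d r n. torus_adj d n x u}
      \<subseteq> {x(j := if x j = 1 then 2 else n - 1)}"
  proof
    fix u assume "u \<in> {u \<in> inactive d r n. torus_adj d n x u}"
    then have u: "u \<in> inactive d r n" "torus_adj d n x u" by auto
    then have uj: "u j \<in> {2..n - 1}" using j by (auto simp: inactive_def PiE_iff)
    have xj: "x j \<in> {1..n}" using x j by (auto simp: torus_verts_def PiE_iff)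
    from x u show "u \<in> {x(j := if x j = 1 then 2 else n - 1)}"
    proof (cases rule: inactive_neighbourE)
      case (1 i)
      then have "i = j" using uj j(2) by (metis fun_upd_other)
      with 1 uj xj j(2) show ?thesis by auto
    next
      case (2 i)
      then have "i = j" using uj j(2) by (metis fun_upd_other)
      moreover have "x j = n" using 2 \<open>i = j\<close> uj xj j(2) by auto
      ultimately show ?thesis using 2 uj by auto
    qed
  qed
  then have "card {u \<in> inactive d r n. torus_adj d n x u} \<le> 1"
    by (metis card_mono finite.emptyI finite.insertI is_singletonI is_singleton_altdef)
  with assms(4) show ?thesis by linarith
qed

text \<open>Downward steps lower the coordinate sum, so only upward ones count: at most
  \<open>s div 2\<close> along weighted coordinates, and possibly all those along the
  \<open>d - r div 2\<close> coordinates of weight 0.\<close>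

lemma card_inactive_neighbours_above:
  assumes "r \<le> 2 * d" "d < r" and x: "x \<in> inactive d r n"
  shows "card {u \<in> inactive d r n. torus_adj d n x u \<and> sum x {1..d} \<le> sum u {1..d}}
    \<le> 2 * d - r"
proof -
  define s where "s = 2 * d - r"
  define a where "a = weight d r x"
  define U where "U = {j \<in> {1..d}. spaced s r (a + int (coord_weight r j))}"
  have s: "s \<le> r" "0 < r" "even (s + r)" using assms by (auto simp: s_def)
  have Pa: "spaced s r a" using x by (simp add: inactive_def a_def s_def)
  have xV: "x \<in> torus_verts d n" using x inactive_subset by blast
  have "{u \<in> inactive d r n. torus_adj d n x u \<and> sum x {1..d} \<le> sum u {1..d}}
      \<subseteq> (\<lambda>j. x(j := x j + 1)) ` U"
  proof
    fix u assume "u \<in> {u \<in> inactive d r n. torus_adj d n x u \<and> sum x {1..d} \<le> sum u {1..d}}"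
    then have u: "u \<in> inactive d r n" "torus_adj d n x u" and le: "sum x {1..d} \<le> sum u {1..d}"
      by auto
    then have P: "spaced s r (weight d r u)" by (simp add: inactive_def s_def)
    from xV u show "u \<in> (\<lambda>j. x(j := x j + 1)) ` U"
    proof (cases rule: inactive_neighbourE)
      case (1 j)
      with P have "j \<in> U" by (simp add: U_def weight_upd a_def)
      with 1 show ?thesis by blast
    next
      case (2 j)
      have "sum x {1..d} = x j + sum x ({1..d} - {j})"
        using 2(1) by (intro sum.remove) auto
      moreover have "sum u {1..d} = x j - 1 + sum x ({1..d} - {j})"
        unfolding 2(3) using 2(1) by (intro sum_fun_upd_remove[where f = "\<lambda>_ y. y"]) auto
      ultimately show ?thesis using le 2(2) by simp
    qed
  qed
  then have "card {u \<in> inactive d r n. torus_adj d n x u \<and> sum x {1..d} \<le> sum u {1..d}}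
      \<le> card ((\<lambda>j. x(j := x j + 1)) ` U)"
    by (intro card_mono) (auto simp: U_def)
  also have "\<dots> \<le> card U" by (intro card_image_le) (auto simp: U_def)
  also have "\<dots> \<le> s div 2 + (d - r div 2)"
    unfolding U_def
    using card_coord_weight[OF assms(1), of "\<lambda>k. spaced s r (a + int k)"]
      card_spaced_half[OF s Pa] Pa by simp
  \<comment> \<open>As \<open>s = 2 * d - r\<close>, halving \<open>s\<close> gives \<open>d\<close>
    minus half of \<open>r\<close> rounded up, which complements \<open>r div 2\<close>.\<close>
  also have "\<dots> = s" using assms(1) s_def by presburger
  finally show ?thesis by (simp add: s_def)
qed

lemma monotone_dynamo_inactive_compl:
  assumes "r \<le> 2 * d" "d < r" "n \<ge> 3"
  shows "monotone_dynamo (torus_verts d n) (torus_adj d n) r (torus_verts d n - inactive d r n)"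
proof -
  let ?V = "torus_verts d n" and ?B = "inactive d r n"
  have B: "?V - (?V - ?B) = ?B" using inactive_subset by blast
  show ?thesis
  proof (rule monotone_dynamo_if_ranked[where s = "2 * d - r" and h = "\<lambda>x. sum x {1..d}"],
      unfold B)
    show "r + (2 * d - r) \<le> card {u \<in> ?V. torus_adj d n v u}" if "v \<in> ?V" for v
      using torus_degree[OF assms(3) that] assms(1) by simp
  next
    fix v assume v: "v \<in> ?V - ?B"
    show "card {u \<in> ?B. torus_adj d n v u} \<le> 2 * d - r"
    proof (cases "spaced (2 * d - r) r (weight d r v)")
      case True
      \<comment> \<open>For \<open>r = 2 * d\<close> nothing is spaced, so this case leaves room for
        the face bound.\<close>
      then have "r \<noteq> 2 * d" using assms by (auto simp: spaced_def not_less)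
      moreover obtain j where "j \<in> {1..d}" "v j \<notin> {2..n - 1}"
        using v True by (auto simp: inactive_def torus_verts_def PiE_iff)
      ultimately show ?thesis
        using card_inactive_neighbours_face[of v d n _ r] v assms(1) by simp
    next
      case False
      then show ?thesis using card_inactive_neighbours_interior[OF assms(1,2)] v by simp
    qed
  next
    show "card {u \<in> ?B. torus_adj d n v u \<and> sum v {1..d} \<le> sum u {1..d}} \<le> 2 * d - r"
      if "v \<in> ?B" for v
      using card_inactive_neighbours_above[OF assms(1,2) that] .
  qed (auto simp: finite_torus_verts)
qed

section \<open>The size of the configuration\<close>

text \<open>Coordinate 1 has weight 1, so on each line in that direction the weights are
  \<open>n - 2\<close> consecutive integers; rounding costs at most 1 per line.\<close>

lemma card_inactive_ge:
  assumes "r \<le> 2 * d" "d < r" "1 \<le> d" "n \<ge> 3"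
  shows "real (card (inactive d r n))
    \<ge> real (n - 2) ^ (d - 1) * (real (2 * d - r) * real (n - 2) / real r - 1)"
proof -
  define s where "s = 2 * d - r"
  define G where "G = {2..d} \<rightarrow>\<^sub>E {2..n - 1}"
  \<comment> \<open>The summand 1 matches the parametrisation in \<open>F\<close>: \<open>y\<close>
    in \<open>{1..n - 2}\<close> stands for the first coordinate \<open>y + 1\<close> in
    \<open>{2..n - 1}\<close>.\<close>
  define W where "W g = (\<Sum>j\<in>{2..d}. int (coord_weight r j) * int (g j)) + 1" for g :: "nat \<Rightarrow> nat"
  define Y where "Y g = {y \<in> {1..n - 2}. spaced s r (W g + int y)}" for g
  define F :: "(nat \<Rightarrow> nat) \<times> nat \<Rightarrow> nat \<Rightarrow> nat" where "F = (\<lambda>(g, y). g(1 := y + 1))"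
  have s: "s \<le> r" "0 < r" using assms by (auto simp: s_def)
  have ins: "{1..d} = insert 1 {2..d}" using assms(3) by auto
  have cw: "coord_weight r (Suc 0) = 1" using assms by (auto simp: coord_weight_def)
  have wF: "weight d r (F (g, y)) = W g + int y" for g y
  proof -
    have "(\<Sum>j\<in>{2..d}. int (coord_weight r j) * int ((g(1 := y + 1)) j))
        = (\<Sum>j\<in>{2..d}. int (coord_weight r j) * int (g j))"
      by (intro sum.cong) auto
    then show ?thesis unfolding weight_def ins F_def W_def by (simp add: cw)
  qed
  have "F ` Sigma G Y \<subseteq> inactive d r n"
  proof clarify
    fix g y assume g: "g \<in> G" and y: "y \<in> Y g"
    have "F (g, y) \<in> {1..d} \<rightarrow>\<^sub>E {2..n - 1}"
      unfolding ins F_def using g y by (auto simp: G_def Y_def intro!: PiE_fun_upd)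
    moreover have "spaced s r (weight d r (F (g, y)))"
      using y by (simp add: wF Y_def)
    ultimately show "F (g, y) \<in> inactive d r n" by (simp add: inactive_def s_def)
  qed
  moreover have "inj_on F (Sigma G Y)"
  proof (rule inj_onI, clarify)
    fix g y g' y' assume g: "g \<in> G" "g' \<in> G" and eq: "F (g, y) = F (g', y')"
    have "g i = g' i" for i
      using fun_cong[OF eq, of i] g by (cases "i = 1") (auto simp: F_def G_def PiE_iff extensional_def)
    moreover have "y = y'" using fun_cong[OF eq, of 1] by (simp add: F_def)
    ultimately show "g = g' \<and> y = y'" by blast
  qed
  ultimately have "card (Sigma G Y) \<le> card (inactive d r n)"
    using finite_subset[OF inactive_subset finite_torus_verts] by (metis card_image card_mono)
  moreover have "real (card (Y g)) \<ge> real s * real (n - 2) / real r - 1" for g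
  proof -
    have "real (card (Y g)) = real_of_int (int (card (Y g)))" by simp
    also have "int (card (Y g)) = (int s * (W g + int (n - 2))) div int r - (int s * W g) div int r"
      unfolding Y_def by (rule card_spaced_above[OF s])
    also have "real_of_int \<dots> \<ge> real_of_int (int s * (W g + int (n - 2))) / real r - 1
        - real_of_int (int s * W g) / real r"
    proof -
      have "real_of_int ((int s * (W g + int (n - 2))) div int r)
          = of_int \<lfloor>real_of_int (int s * (W g + int (n - 2))) / real r\<rfloor>"
        using floor_divide_of_int_eq[of "int s * (W g + int (n - 2))" "int r", where 'a = real] by simp
      moreover have "real_of_int ((int s * W g) div int r)
          = of_int \<lfloor>real_of_int (int s * W g) / real r\<rfloor>"
        using floor_divide_of_int_eq[of "int s * W g" "int r", where 'a = real] by simp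
      ultimately show ?thesis by linarith
    qed
    also have "real_of_int (int s * (W g + int (n - 2))) / real r - 1
        - real_of_int (int s * W g) / real r = real s * real (n - 2) / real r - 1"
      by (simp add: field_simps add_divide_distrib)
    finally show ?thesis .
  qed
  then have "(\<Sum>g\<in>G. real s * real (n - 2) / real r - 1) \<le> (\<Sum>g\<in>G. real (card (Y g)))"
    by (intro sum_mono)
  moreover have "card G = (n - 2) ^ (d - 1)"
    using assms(3) by (simp add: G_def card_PiE numeral_2_eq_2)
  moreover have "card (Sigma G Y) = (\<Sum>g\<in>G. card (Y g))"
    by (rule card_SigmaI) (auto simp: G_def Y_def finite_PiE)
  ultimately show ?thesis by (simp add: s_def flip: of_nat_sum)
qed

text \<open>This is Bernoulli's inequality at \<open>- 2 / x\<close>, scaled by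
  \<open>x ^ d\<close>.\<close>

lemma power_minus_two_ge:
  fixes x :: real
  assumes "x \<ge> 2" "1 \<le> d"
  shows "(x - 2) ^ d \<ge> x ^ d - 2 * real d * x ^ (d - 1)"
proof -
  have "1 + real d * (- 2 / x) \<le> (1 + - 2 / x) ^ d"
    using assms by (intro Bernoulli_inequality) (simp add: field_simps)
  then have "x ^ d * (1 + real d * (- 2 / x)) \<le> x ^ d * (1 + - 2 / x) ^ d"
    using assms by (intro mult_left_mono) auto
  also have "\<dots> = (x - 2) ^ d"
    using assms by (simp add: field_simps flip: power_mult_distrib)
  also have "x ^ d * (1 + real d * (- 2 / x)) = x ^ d - 2 * real d * x ^ (d - 1)"
    using assms by (cases d) (auto simp: field_simps)
  finally show ?thesis .
qed

theorem theorem3: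
  fixes d r :: nat
  assumes "1 \<le> d" and "d + 1 \<le> r" and "r \<le> 2 * d"
  shows "\<exists>C::real. C > 0 \<and> (\<exists>n0::nat. \<forall>n\<ge>n0.
           real (m_mon (torus_verts d n) (torus_adj d n) r)
             \<le> 2 * (1 - real d / real r) * real n ^ d + C * real n ^ (d - 1))"
proof (intro exI[of _ "2 * real d + 1"] exI[of _ 3] conjI allI impI)
  \<comment> \<open>In the constant, \<open>2 * d\<close> pays for the active faces and 1 for the
    rounding on each line; \<open>n \<ge> 3\<close> gives every vertex \<open>2 * d\<close> distinct
    neighbours.\<close>
  fix n :: nat assume n: "3 \<le> n"
  let ?V = "torus_verts d n" and ?B = "inactive d r n"
  define q where "q = real (2 * d - r) / real r"
  have q: "0 \<le> q" "q \<le> 1" using assms by (auto simp: q_def)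
  have q_eq: "1 - q = 2 * (1 - real d / real r)"
    using assms by (simp add: q_def of_nat_diff field_simps)
  have n2: "real (n - 2) = real n - 2" using n by simp
  have pw: "real (n - 2) ^ d = real (n - 2) ^ (d - 1) * real (n - 2)"
    using assms(1) by (simp add: power_eq_if)
  have "monotone_dynamo ?V (torus_adj d n) r (?V - ?B)"
    using monotone_dynamo_inactive_compl assms n by simp
  then have "m_mon ?V (torus_adj d n) r \<le> card (?V - ?B)"
    unfolding m_mon_def by (intro cInf_lower) auto
  then have "real (m_mon ?V (torus_adj d n) r) \<le> real (card (?V - ?B))" by simp
  also have "\<dots> = real n ^ d - real (card ?B)"
  proof -
    have "card ?V = n ^ d" by (simp add: torus_verts_def card_PiE)
    moreover have "card (?V - ?B) = card ?V - card ?B"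
      using finite_subset[OF inactive_subset finite_torus_verts] inactive_subset
      by (intro card_Diff_subset)
    moreover have "card ?B \<le> card ?V" by (intro card_mono finite_torus_verts inactive_subset)
    ultimately show ?thesis by (simp add: of_nat_diff)
  qed
  also have "\<dots> \<le> real n ^ d - (q * real (n - 2) ^ d - real (n - 2) ^ (d - 1))"
  proof -
    have "real (n - 2) ^ (d - 1) * (real (2 * d - r) * real (n - 2) / real r - 1)
        = q * real (n - 2) ^ d - real (n - 2) ^ (d - 1)"
      unfolding pw q_def right_diff_distrib by simp
    then show ?thesis using card_inactive_ge[of r d n] assms n by simp
  qed
  also have "\<dots> \<le> real n ^ d - q * (real n ^ d - 2 * real d * real n ^ (d - 1)) + real n ^ (d - 1)"
  proof -
    have "q * (real n ^ d - 2 * real d * real n ^ (d - 1)) \<le> q * real (n - 2) ^ d"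
      unfolding n2 using q assms(1) n by (intro mult_left_mono power_minus_two_ge) auto
    moreover have "real (n - 2) ^ (d - 1) \<le> real n ^ (d - 1)"
      by (intro power_mono) auto
    ultimately show ?thesis by linarith
  qed
  also have "\<dots> = (1 - q) * real n ^ d + (q * (2 * real d) + 1) * real n ^ (d - 1)"
    by (simp add: algebra_simps)
  also have "\<dots> \<le> (1 - q) * real n ^ d + (2 * real d + 1) * real n ^ (d - 1)"
    using q by (intro add_left_mono mult_right_mono add_right_mono) (auto intro: mult_left_le_one_le)
  finally show "real (m_mon ?V (torus_adj d n) r)
      \<le> 2 * (1 - real d / real r) * real n ^ d + (2 * real d + 1) * real n ^ (d - 1)"
    unfolding q_eq .
qed auto

end
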